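(* Let $X$ be a finite set and let $f$ be a complementary choice function on $X$. Then there is a supermodular set-function $u:2^X\to\mathbb R$ which generates $f$, i.e. for every $A\subseteq X$, $f(A)$ is the least (by inclusion) subset of $A$ at which $u$ attains its maximum over all subsets of $A$.
   Context: A choice function (CF) on $X$ is a map $f:2^X\to 2^X$ with $f(A)\subseteq A$ for all $A$. A CF is consistent if $f(A)\subseteq B\subseteq A$ implies $f(B)=f(A)$; monotonic if $A\subseteq B$ implies $f(A)\subseteq f(B)$; complementary if consistent and monotonic. A set-function $u:2^X\to\mathbb R$ is supermodular if $u(A)+u(B)\le u(A\cap B)+u(A\cup B)$ for all $A,B\subseteq X$. For supermodular $u$, the set of maximizers of $u$ on $2^A$ is closed under union and intersection, so it has a least element with respect to inclusion; $u$ generates $f$ if $f(A)$ equals this least maximizer for every $A$. *)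

theory Defs
  imports Complex_Main
begin

text \<open>
  Maps on the power set of \<open>X\<close> are represented by total functions on \<open>'a set\<close>; only their values
  on subsets of \<open>X\<close> are constrained.
\<close>

definition choice_function :: "'a set \<Rightarrow> ('a set \<Rightarrow> 'a set) \<Rightarrow> bool" where
  "choice_function X f \<longleftrightarrow> (\<forall>A\<subseteq>X. f A \<subseteq> A)"

definition consistent :: "'a set \<Rightarrow> ('a set \<Rightarrow> 'a set) \<Rightarrow> bool" where
  "consistent X f \<longleftrightarrow> (\<forall>A\<subseteq>X. \<forall>B. f A \<subseteq> B \<and> B \<subseteq> A \<longrightarrow> f B = f A)"

definition complementary :: "'a set \<Rightarrow> ('a set \<Rightarrow> 'a set) \<Rightarrow> bool" where
  "complementary X f \<longleftrightarrow> consistent X f \<and> mono_on (Pow X) f"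

definition supermodular :: "'a set \<Rightarrow> ('a set \<Rightarrow> real) \<Rightarrow> bool" where
  "supermodular X u \<longleftrightarrow> (\<forall>A\<subseteq>X. \<forall>B\<subseteq>X. u A + u B \<le> u (A \<inter> B) + u (A \<union> B))"

definition maximizers :: "('a set \<Rightarrow> real) \<Rightarrow> 'a set \<Rightarrow> 'a set set" where
  "maximizers u A = {B. is_arg_max u (\<lambda>C. C \<subseteq> A) B}"

definition generates :: "'a set \<Rightarrow> ('a set \<Rightarrow> real) \<Rightarrow> ('a set \<Rightarrow> 'a set) \<Rightarrow> bool" where
  "generates X u f \<longleftrightarrow>
     (\<forall>A\<subseteq>X. f A \<in> maximizers u A \<and> (\<forall>B\<in>maximizers u A. f A \<subseteq> B))"

end

theory Submission
  imports Defs
begin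

text \<open>
  A complementary choice function sends \<open>A\<close> to the largest fixed point of \<open>f\<close> inside \<open>A\<close>. Let
  \<open>u A\<close> be the number of fixed points contained in \<open>A\<close>. It is a sum of the supermodular
  functions \<open>A \<mapsto> [C \<subseteq> A]\<close>, and a subset of \<open>A\<close> attains the value \<open>u A\<close> exactly if it
  contains every fixed point inside \<open>A\<close>, i.e. if it contains \<open>f A\<close>.
\<close>

definition fixed_subsets :: "('a set \<Rightarrow> 'a set) \<Rightarrow> 'a set \<Rightarrow> 'a set set" where
  "fixed_subsets f A = {C. C \<subseteq> A \<and> f C = C}"

lemma fixed_subsets_mono: "A \<subseteq> B \<Longrightarrow> fixed_subsets f A \<subseteq> fixed_subsets f B"
  by (auto simp: fixed_subsets_def)

lemma finite_fixed_subsets: "finite A \<Longrightarrow> finite (fixed_subsets f A)"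
  by (rule finite_subset[of _ "Pow A"]) (auto simp: fixed_subsets_def)

text \<open>Inclusion-exclusion for two families of fixed points: their intersection is exactly the
  family for \<open>A \<inter> B\<close>, while their union may miss fixed points inside
  \<open>A \<union> B\<close> that lie in neither set; hence only an inequality.\<close>

lemma supermodular_card_fixed_subsets:
  assumes "finite X"
  shows "supermodular X (\<lambda>A. real (card (fixed_subsets f A)))"
  unfolding supermodular_def
proof (intro allI impI)
  fix A B assume "A \<subseteq> X" "B \<subseteq> X"
  then have fin: "finite (fixed_subsets f A)" "finite (fixed_subsets f B)"
      "finite (fixed_subsets f (A \<union> B))"
    using assms by (auto intro!: finite_fixed_subsets intro: finite_subset)
  have "card (fixed_subsets f A) + card (fixed_subsets f B)
      = card (fixed_subsets f A \<inter> fixed_subsets f B)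
        + card (fixed_subsets f A \<union> fixed_subsets f B)"
    using card_Un_Int[OF fin(1,2)] by simp
  also have "fixed_subsets f A \<inter> fixed_subsets f B = fixed_subsets f (A \<inter> B)"
    by (auto simp: fixed_subsets_def)
  also have "card (fixed_subsets f A \<union> fixed_subsets f B) \<le> card (fixed_subsets f (A \<union> B))"
    by (intro card_mono fin(3) Un_least fixed_subsets_mono) auto
  finally show "real (card (fixed_subsets f A)) + real (card (fixed_subsets f B))
      \<le> real (card (fixed_subsets f (A \<inter> B))) + real (card (fixed_subsets f (A \<union> B)))"
    by linarith
qed

text \<open>Consistency makes \<open>f A\<close> a fixed point, and monotonicity makes it the
  largest one inside \<open>A\<close>. Shrinking \<open>A\<close> to \<open>f A\<close> therefore
  loses no fixed point.\<close>

lemma complementary_fixed_subsets: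
  assumes "choice_function X f" and "complementary X f" and "A \<subseteq> X"
  shows "f A \<in> fixed_subsets f A" and "fixed_subsets f A = fixed_subsets f (f A)"
proof -
  have sub: "f A \<subseteq> A"
    using assms by (auto simp: choice_function_def)
  \<comment> \<open>Consistency, with \<open>f A\<close> itself as the intermediate set.\<close>
  moreover have "f (f A) = f A"
    using assms sub unfolding complementary_def consistent_def by blast
  ultimately show "f A \<in> fixed_subsets f A"
    by (simp add: fixed_subsets_def)
  have "C \<subseteq> f A" if "C \<subseteq> A" "f C = C" for C
  proof -
    have "f C \<subseteq> f A"
      using assms(2,3) that(1) by (intro mono_onD[of "Pow X" f]) (auto simp: complementary_def)
    then show ?thesis using that by simp
  qed
  with sub show "fixed_subsets f A = fixed_subsets f (f A)"
    by (auto simp: fixed_subsets_def)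
qed

lemma generates_card_fixed_subsets:
  assumes "finite X" and "choice_function X f" and "complementary X f"
  shows "generates X (\<lambda>A. real (card (fixed_subsets f A))) f"
  unfolding generates_def
proof (intro allI impI conjI ballI)
  let ?u = "\<lambda>A. real (card (fixed_subsets f A))"
  fix A assume A: "A \<subseteq> X"
  note fA = complementary_fixed_subsets[OF assms(2,3) A]
  have fin: "finite (fixed_subsets f A)"
    using A assms(1) by (meson finite_fixed_subsets finite_subset)
  have sub: "f A \<subseteq> A"
    using fA(1) by (simp add: fixed_subsets_def)
  have le: "?u B \<le> ?u (f A)" if "B \<subseteq> A" for B
    using card_mono[OF fin fixed_subsets_mono[OF that]] fA(2) by simp
  show "f A \<in> maximizers ?u A"
    using sub le by (auto simp: maximizers_def is_arg_max_def not_less)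
  fix B assume "B \<in> maximizers ?u A"
  then have B: "B \<subseteq> A" and "\<not> ?u B < ?u (f A)"
    using sub by (auto simp: maximizers_def is_arg_max_def)
  then have "card (fixed_subsets f A) \<le> card (fixed_subsets f B)"
    using fA(2) by simp
  \<comment> \<open>Equal counts of nested finite families force equality, so the fixed point
    \<open>f A\<close> is also counted for \<open>B\<close>, that is, lies inside it.\<close>
  then have "fixed_subsets f B = fixed_subsets f A"
    by (intro card_seteq fin fixed_subsets_mono B)
  with fA(1) show "f A \<subseteq> B"
    by (auto simp: fixed_subsets_def)
qed

theorem theorem3:
  fixes X :: "'a set" and f :: "'a set \<Rightarrow> 'a set"
  assumes "finite X"
    and "choice_function X f"
    and "complementary X f"
  shows "\<exists>u :: 'a set \<Rightarrow> real. supermodular X u \<and> generates X u f"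
  using supermodular_card_fixed_subsets[OF assms(1)] generates_card_fixed_subsets[OF assms]
  by blast

end
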